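(* For any graph $G$, we have $$d_{0} + \frac{1}{2}d_{1} - 1 \;\leq\; u(G) \;\leq\; d_{0} + \frac{3}{4}d_{1} + \frac{1}{2}d_{2} + \frac{1}{4}d_{3},$$ where $d_{i}$ denotes the number of vertices of $G$ with degree exactly $i$.
   Context: Graphs are finite and simple. The Toucher-Isolator game on a graph $G=(V(G),E(G))$: two players, Toucher and Isolator, alternately claim previously unclaimed edges of $G$, one edge per move, with Toucher making the first move, until all edges are claimed. A vertex is touched if it is incident to at least one edge claimed by Toucher, and untouched otherwise (i.e. all of its incident edges have been claimed by Isolator; in particular a vertex of degree $0$ is untouched). Toucher aims to minimise, and Isolator to maximise, the number of untouched vertices at the end of the game. $u(G)$ denotes the number of untouched vertices at the end of the game when both players play optimally (the minimax value of this game). *)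

theory Defs
  imports Complex_Main
begin

definition simple_graph :: "'a set \<Rightarrow> 'a set set \<Rightarrow> bool" where
  "simple_graph V E \<longleftrightarrow> finite V \<and> (\<forall>e\<in>E. e \<subseteq> V \<and> card e = 2)"

definition degree :: "'a set set \<Rightarrow> 'a \<Rightarrow> nat" where
  "degree E v = card {e \<in> E. v \<in> e}"

definition num_degree :: "'a set \<Rightarrow> 'a set set \<Rightarrow> nat \<Rightarrow> nat" where
  "num_degree V E i = card {v \<in> V. degree E v = i}"

definition untouched :: "'a set \<Rightarrow> 'a set set \<Rightarrow> 'a set" where
  "untouched V T = {v \<in> V. \<not> (\<exists>e\<in>T. v \<in> e)}"

datatype player = Toucher | Isolator

text \<open>
  \<^term>\<open>game_value V p U T\<close> is the minimax value of the position in which player \<^term>\<open>p\<close> is to move,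
  \<^term>\<open>U\<close> is the set of unclaimed edges and \<^term>\<open>T\<close> the set of edges claimed by Toucher so far.
  Isolator's edges are the remaining ones and need not be recorded. For infinite \<^term>\<open>U\<close>,
  which does not occur for simple graphs, the value is a dummy.
\<close>

function (sequential) game_value :: "'a set \<Rightarrow> player \<Rightarrow> 'a set set \<Rightarrow> 'a set set \<Rightarrow> nat" where
  "game_value V Toucher U T =
     (if U = {} \<or> infinite U then card (untouched V T)
      else Min ((\<lambda>e. game_value V Isolator (U - {e}) (insert e T)) ` U))"
| "game_value V Isolator U T =
     (if U = {} \<or> infinite U then card (untouched V T)
      else Max ((\<lambda>e. game_value V Toucher (U - {e}) T) ` U))"
  by pat_completeness auto
termination
  by (relation "measure (\<lambda>(V, p, U, T). card U)") (auto simp: card_gt_0_iff)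

declare game_value.simps [simp del]

definition untouched_number :: "'a set \<Rightarrow> 'a set set \<Rightarrow> nat" where
  "untouched_number V E = game_value V Toucher E {}"

end

theory Submission
  imports Defs
begin

text \<open>
  Both bounds are proved with a potential that charges every untouched vertex for the number \<open>k\<close>
  of unclaimed edges still able to save it: 2 for \<open>k = 0\<close>, 1 for \<open>k = 1\<close> and 0 otherwise. Half of
  the potential estimates the number of vertices that end up untouched.

  Lower bound. Isolator only cares about the vertices of degree at most 1. He always claims the
  edge with the largest number \<open>m\<close> of untouched leaves among its ends. This gains \<open>m\<close>, and
  Toucher's next move destroys at most \<open>m\<close>, so only the loss from Toucher's very first move, at most
  2, remains (\<open>leaf_potential_le_game_value\<close>).

  Upper bound. Suppose every edge is owned by one of its ends, so that the sets of edges owned by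
  different vertices are disjoint. Toucher can save every vertex owning two edges, by answering in
  the same set, and at least half of the vertices owning exactly one
  (\<open>game_value_le_ownership_potential\<close>). Now orient the graph so that in- and outdegree differ by at
  most 1 everywhere (\<open>balanced_orientation\<close>). Letting each edge be owned by its tail, or each by its
  head, gives two strategies. A vertex of degree 0, 1, 2, 3 is charged 4, 3, 2, 1 in both together,
  and one of higher degree is charged nothing; hence the better strategy gives the claim.
\<close>

section \<open>Moves in the game\<close>

lemma game_value_end: "game_value V p {} T = card (untouched V T)"
  by (cases p) (simp_all add: game_value.simps)

lemma game_value_Toucher_le:
  assumes "finite U" "e \<in> U"
  shows "game_value V Toucher U T \<le> game_value V Isolator (U - {e}) (insert e T)"
  using assms by (auto simp: game_value.simps(1) intro!: Min_le)

lemma game_value_Isolator_ge: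
  assumes "finite U" "e \<in> U"
  shows "game_value V Toucher (U - {e}) T \<le> game_value V Isolator U T"
  using assms by (auto simp: game_value.simps(2) intro!: Max_ge)

lemma Toucher_optimal_move:
  assumes "finite U" "U \<noteq> {}"
  obtains e where "e \<in> U"
    "game_value V Toucher U T = game_value V Isolator (U - {e}) (insert e T)"
proof -
  have "Min ((\<lambda>e. game_value V Isolator (U - {e}) (insert e T)) ` U)
      \<in> (\<lambda>e. game_value V Isolator (U - {e}) (insert e T)) ` U"
    using assms by (intro Min_in) auto
  then have "game_value V Toucher U T
      \<in> (\<lambda>e. game_value V Isolator (U - {e}) (insert e T)) ` U"
    using assms by (simp only: game_value.simps(1)) simp
  then show thesis using that by blast
qed

lemma Isolator_optimal_move:
  assumes "finite U" "U \<noteq> {}"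
  obtains e where "e \<in> U" "game_value V Isolator U T = game_value V Toucher (U - {e}) T"
proof -
  have "Max ((\<lambda>e. game_value V Toucher (U - {e}) T) ` U)
      \<in> (\<lambda>e. game_value V Toucher (U - {e}) T) ` U"
    using assms by (intro Max_in) auto
  then have "game_value V Isolator U T \<in> (\<lambda>e. game_value V Toucher (U - {e}) T) ` U"
    using assms by (simp only: game_value.simps(2)) simp
  then show thesis using that by blast
qed

lemma untouched_insert: "untouched V (insert e T) = untouched V T - e"
  by (auto simp: untouched_def)

lemma finite_untouched: "finite V \<Longrightarrow> finite (untouched V T)"
  by (simp add: untouched_def)

lemma degree_Diff_singleton:
  assumes "finite U" "e \<in> U"
  shows "degree (U - {e}) v = degree U v - (if v \<in> e then 1 else 0)"
proof -
  have "{f \<in> U - {e}. v \<in> f} = {f \<in> U. v \<in> f} - {e}" by auto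
  with assms show ?thesis by (auto simp: degree_def)
qed

lemma degree_pos: "finite U \<Longrightarrow> e \<in> U \<Longrightarrow> v \<in> e \<Longrightarrow> 0 < degree U v"
  by (auto simp: degree_def card_gt_0_iff)

section \<open>Isolator collects leaves\<close>

text \<open>
  The set \<open>L\<close> is fixed once and for all: vertices that become leaves during the game are ignored, so
  Isolator's move cannot make another edge more valuable. After Isolator has claimed an edge with
  the maximal number \<open>m\<close> of untouched leaves, \<open>m\<close> still bounds every remaining edge, and the
  potential has grown by exactly the \<open>m\<close> that the second inequality then gives away.
\<close>

lemma leaf_potential_le_game_value:
  assumes "finite V" "L \<subseteq> V" "finite U" "\<forall>v\<in>L. degree U v \<le> 1"
  shows "(\<Sum>v\<in>L \<inter> untouched V T. 2 - degree U v) \<le> 2 * game_value V Isolator U T"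
    and "(\<forall>e\<in>U. card (L \<inter> untouched V T \<inter> e) \<le> m) \<Longrightarrow>
      (\<Sum>v\<in>L \<inter> untouched V T. 2 - degree U v) \<le> 2 * game_value V Toucher U T + m"
proof -
  have fin: "finite (L \<inter> untouched V S)" for S
    using assms(1) by (simp add: finite_untouched)
  have "(\<Sum>v\<in>L \<inter> untouched V T. 2 - degree U v) \<le> 2 * game_value V Isolator U T \<and>
    (\<forall>m. (\<forall>e\<in>U. card (L \<inter> untouched V T \<inter> e) \<le> m) \<longrightarrow>
      (\<Sum>v\<in>L \<inter> untouched V T. 2 - degree U v) \<le> 2 * game_value V Toucher U T + m)"
    using assms(3,4)
  proof (induction U arbitrary: T rule: finite_psubset_induct)
    case (psubset U)
    note finU = psubset.hyps
    let ?X = "L \<inter> untouched V T"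
    have leaf: "degree U v = 1" if "v \<in> L" "v \<in> e" "e \<in> U" for v e
      using degree_pos[OF finU that(3,2)] psubset.prems that(1) by fastforce
    show ?case
    proof (cases "U = {}")
      case True
      have "card ?X \<le> card (untouched V T)"
        using assms(1) by (intro card_mono finite_untouched) auto
      then show ?thesis by (simp add: True game_value_end degree_def)
    next
      case False
      have smaller: "U - {e} \<subset> U" "\<forall>v\<in>L. degree (U - {e}) v \<le> 1" if "e \<in> U" for e
        using that psubset.prems by (auto simp: degree_Diff_singleton[OF finU])
      note IH = psubset.IH[OF smaller]
      have Isolator: "(\<Sum>v\<in>?X. 2 - degree U v) \<le> 2 * game_value V Isolator U T"
      proof -
        define m where "m = Max ((\<lambda>e. card (?X \<inter> e)) ` U)"
        have "m \<in> (\<lambda>e. card (?X \<inter> e)) ` U"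
          unfolding m_def using finU False by (intro Max_in) auto
        then obtain e where e: "e \<in> U" "m = card (?X \<inter> e)" by auto
        have "\<forall>f\<in>U. card (?X \<inter> f) \<le> m"
          unfolding m_def using finU by (auto intro!: Max_ge)
        then have "(\<Sum>v\<in>?X. 2 - degree (U - {e}) v) \<le> 2 * game_value V Toucher (U - {e}) T + m"
          using IH[OF e(1) e(1)] by blast
        moreover have "(\<Sum>v\<in>?X. 2 - degree (U - {e}) v) = (\<Sum>v\<in>?X. 2 - degree U v) + m"
        proof -
          have "(\<Sum>v\<in>?X. 2 - degree (U - {e}) v)
              = (\<Sum>v\<in>?X. (2 - degree U v) + (if v \<in> e then 1 else 0))"
            using e(1) leaf by (intro sum.cong) (auto simp: degree_Diff_singleton[OF finU])
          also have "\<dots> = (\<Sum>v\<in>?X. 2 - degree U v) + m"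
            using fin by (simp add: sum.distrib e(2) sum.inter_restrict[symmetric])
          finally show ?thesis .
        qed
        ultimately show ?thesis
          using game_value_Isolator_ge[OF finU e(1), of V T] by linarith
      qed
      have Toucher: "(\<Sum>v\<in>?X. 2 - degree U v) \<le> 2 * game_value V Toucher U T + m"
        if m: "\<forall>e\<in>U. card (?X \<inter> e) \<le> m" for m
      proof -
        obtain e where e: "e \<in> U"
          "game_value V Toucher U T = game_value V Isolator (U - {e}) (insert e T)"
          using Toucher_optimal_move[OF finU False] .
        have "(\<Sum>v\<in>?X. 2 - degree U v)
            = (\<Sum>v\<in>?X - e. 2 - degree U v) + (\<Sum>v\<in>?X \<inter> e. 2 - degree U v)"
          using fin by (subst sum.Int_Diff[of _ _ e]) (auto simp: add.commute)
        also have "(\<Sum>v\<in>?X \<inter> e. 2 - degree U v) = (\<Sum>v\<in>?X \<inter> e. 1)"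
          using leaf[OF _ _ e(1)] by (intro sum.cong) auto
        also have "(\<Sum>v\<in>?X \<inter> e. 1::nat) = card (?X \<inter> e)" by simp
        also have "(\<Sum>v\<in>?X - e. 2 - degree U v)
            = (\<Sum>v\<in>L \<inter> untouched V (insert e T). 2 - degree (U - {e}) v)"
          using e(1)
          by (intro sum.cong) (auto simp: untouched_insert degree_Diff_singleton[OF finU])
        also have "\<dots> \<le> 2 * game_value V Isolator (U - {e}) (insert e T)"
          using IH[OF e(1) e(1)] by blast
        finally show ?thesis using m e by fastforce
      qed
      from Isolator Toucher show ?thesis by blast
    qed
  qed
  then show "(\<Sum>v\<in>L \<inter> untouched V T. 2 - degree U v) \<le> 2 * game_value V Isolator U T"
    and "(\<forall>e\<in>U. card (L \<inter> untouched V T \<inter> e) \<le> m) \<Longrightarrow>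
      (\<Sum>v\<in>L \<inter> untouched V T. 2 - degree U v) \<le> 2 * game_value V Toucher U T + m"
    by blast+
qed

lemma simple_graph_finite_edges: "simple_graph V E \<Longrightarrow> finite E"
  unfolding simple_graph_def by (rule finite_subset[of E "Pow V"]) auto

theorem untouched_number_ge:
  assumes "simple_graph V E"
  shows "2 * num_degree V E 0 + num_degree V E 1 \<le> 2 * untouched_number V E + 2"
proof -
  have V: "finite V" and two: "\<And>e. e \<in> E \<Longrightarrow> card e = 2"
    using assms by (auto simp: simple_graph_def)
  let ?Z = "{v \<in> V. degree E v = 0}" and ?O = "{v \<in> V. degree E v = 1}"
  let ?L = "?Z \<union> ?O"
  have "2 * num_degree V E 0 + num_degree V E 1
      = (\<Sum>v\<in>?Z. 2 - degree E v) + (\<Sum>v\<in>?O. 2 - degree E v)"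
    by (simp add: num_degree_def)
  also have "\<dots> = (\<Sum>v\<in>?L. 2 - degree E v)"
    using V by (intro sum.union_disjoint[symmetric]) auto
  also have "?L = ?L \<inter> untouched V {}" by (auto simp: untouched_def)
  also have "(\<Sum>v\<in>?L \<inter> untouched V {}. 2 - degree E v) \<le> 2 * untouched_number V E + 2"
    unfolding untouched_number_def
  proof (rule leaf_potential_le_game_value(2))
    show "\<forall>e\<in>E. card (?L \<inter> untouched V {} \<inter> e) \<le> 2"
    proof
      fix e assume "e \<in> E"
      then have "card e = 2" by (rule two)
      moreover from this have "finite e" by (intro card_ge_0_finite) simp
      ultimately show "card (?L \<inter> untouched V {} \<inter> e) \<le> 2"
        using card_mono[of e "?L \<inter> untouched V {} \<inter> e"] by auto
    qed
  qed (use V simple_graph_finite_edges[OF assms] in auto)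
  finally show ?thesis .
qed

section \<open>Toucher plays on disjoint sets of edges\<close>

definition charge :: "nat \<Rightarrow> nat" where
  "charge k = 2 - k"

definition owned :: "('a set \<Rightarrow> 'a) \<Rightarrow> 'a set set \<Rightarrow> 'a \<Rightarrow> 'a set set" where
  "owned own U v = {e \<in> U. own e = v}"

definition potential :: "'a set \<Rightarrow> ('a set \<Rightarrow> 'a) \<Rightarrow> 'a set set \<Rightarrow> 'a set set \<Rightarrow> nat" where
  "potential V own U T = (\<Sum>v\<in>untouched V T. charge (card (owned own U v)))"

lemma owned_Diff_singleton_other: "own e \<noteq> v \<Longrightarrow> owned own (U - {e}) v = owned own U v"
  by (auto simp: owned_def)

lemma potential_Isolator_move:
  assumes "finite V" "finite U" "e \<in> U"
  shows "potential V own (U - {e}) T \<le> potential V own U T + 1"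
proof -
  let ?A = "untouched V T"
  have "charge (card (owned own (U - {e}) v))
      \<le> charge (card (owned own U v)) + (if v = own e then 1 else 0)" for v
  proof (cases "v = own e")
    case True
    then have "owned own (U - {e}) v = owned own U v - {e}" "e \<in> owned own U v"
      using assms(3) by (auto simp: owned_def)
    then show ?thesis using True by (simp add: charge_def card_Diff_singleton)
  qed (simp add: owned_Diff_singleton_other)
  then have "potential V own (U - {e}) T
      \<le> (\<Sum>v\<in>?A. charge (card (owned own U v)) + (if v = own e then 1 else 0))"
    unfolding potential_def by (intro sum_mono)
  also have "\<dots> \<le> potential V own U T + 1"
    using assms(1) by (simp add: potential_def sum.distrib finite_untouched)
  finally show ?thesis .
qed

lemma potential_Toucher_move:
  assumes "finite V" "own e \<in> e"
  shows "potential V own (U - {e}) (insert e T)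
      + (if own e \<in> untouched V T then charge (card (owned own U (own e))) else 0)
    \<le> potential V own U T"
proof -
  let ?A = "untouched V T" and ?c = "\<lambda>v. charge (card (owned own U v))"
  have fin: "finite ?A" using assms(1) by (rule finite_untouched)
  have "potential V own (U - {e}) (insert e T) = sum ?c (?A - e)"
    unfolding potential_def untouched_insert
  proof (rule sum.cong)
    fix v assume "v \<in> ?A - e"
    then have "own e \<noteq> v" using assms(2) by auto
    then show "charge (card (owned own (U - {e}) v)) = ?c v"
      by (simp add: owned_Diff_singleton_other)
  qed simp
  also have "\<dots> \<le> sum ?c (?A - {own e})"
    using fin assms(2) by (intro sum_mono2) auto
  finally have "potential V own (U - {e}) (insert e T) \<le> sum ?c (?A - {own e})" .
  moreover have "potential V own U T
      = sum ?c (?A - {own e}) + (if own e \<in> ?A then ?c (own e) else 0)"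
    unfolding potential_def using fin by (auto simp: sum.remove)
  ultimately show ?thesis by simp
qed

text \<open>
  The two players' bounds differ by 1, which is what a single move of Isolator can add. On his turn
  Toucher wins this 1 back by saving a vertex that owns a single edge. If there is no such vertex,
  the potential is even, and 1 is lost in rounding since the number of untouched vertices is an
  integer; so any move will do.
\<close>

lemma game_value_le_ownership_potential:
  assumes "finite V" "finite U" "\<forall>e\<in>U. own e \<in> e"
  shows "2 * game_value V Toucher U T \<le> potential V own U T"
    and "2 * game_value V Isolator U T \<le> potential V own U T + 1"
proof -
  have "2 * game_value V Toucher U T \<le> potential V own U T
    \<and> 2 * game_value V Isolator U T \<le> potential V own U T + 1"
    using assms(2,3)
  proof (induction U arbitrary: T rule: finite_psubset_induct)
    case (psubset U)
    note finU = psubset.hyps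
    show ?case
    proof (cases "U = {}")
      case True
      then show ?thesis by (simp add: game_value_end potential_def owned_def charge_def)
    next
      case False
      have smaller: "U - {e} \<subset> U" "\<forall>f\<in>U - {e}. own f \<in> f" if "e \<in> U" for e
        using that psubset.prems by auto
      note IH = psubset.IH[OF smaller]
      have Toucher: "2 * game_value V Toucher U T
          \<le> potential V own (U - {e}) (insert e T) + 1" if "e \<in> U" for e
        using IH[OF that that, of "insert e T"] game_value_Toucher_le[OF finU that, of V T]
        by linarith
      have "2 * game_value V Toucher U T \<le> potential V own U T"
      proof (cases "\<exists>v\<in>untouched V T. card (owned own U v) = 1")
        case True
        then obtain v e where v: "v \<in> untouched V T" "owned own U v = {e}"
          by (auto simp: card_1_singleton_iff)
        then have "e \<in> owned own U v" by simp
        then have e: "e \<in> U" "own e = v" by (simp_all add: owned_def)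
        then show ?thesis
          using Toucher[OF e(1)] potential_Toucher_move[OF assms(1), of own e U T] v
            psubset.prems
          by (auto simp: charge_def)
      next
        case no_single: False
        have "2 dvd charge (card (owned own U v))" if "v \<in> untouched V T" for v
        proof -
          have "card (owned own U v) \<noteq> 1" using no_single that by blast
          then have "charge (card (owned own U v)) \<in> {0, 2}" by (auto simp: charge_def)
          then show ?thesis by auto
        qed
        then have "2 dvd potential V own U T"
          unfolding potential_def by (rule dvd_sum)
        then obtain k where k: "potential V own U T = 2 * k" by (rule dvdE)
        obtain e where e: "e \<in> U" using False by blast
        have "potential V own (U - {e}) (insert e T) \<le> potential V own U T"
          using potential_Toucher_move[OF assms(1), of own e U T] e psubset.prems by auto
        then have "2 * game_value V Toucher U T \<le> 2 * k + 1"
          using Toucher[OF e] k by linarith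
        then have "game_value V Toucher U T \<le> k" by presburger
        then show ?thesis using k by simp
      qed
      moreover have "2 * game_value V Isolator U T \<le> potential V own U T + 1"
      proof -
        obtain e where e: "e \<in> U" "game_value V Isolator U T = game_value V Toucher (U - {e}) T"
          using Isolator_optimal_move[OF finU False] .
        then show ?thesis
          using IH[OF e(1) e(1), of T] potential_Isolator_move[OF assms(1) finU e(1), of own T]
          by linarith
      qed
      ultimately show ?thesis by blast
    qed
  qed
  then show "2 * game_value V Toucher U T \<le> potential V own U T"
    and "2 * game_value V Isolator U T \<le> potential V own U T + 1" by blast+
qed

section \<open>Balanced orientations\<close>

definition incidence :: "'v \<Rightarrow> 'v \<Rightarrow> 'v \<Rightarrow> int" where
  "incidence x y v = (if v = x then 1 else 0) - (if v = y then 1 else 0)"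

text \<open>
  Two edges that share an end have, up to a sign, incidence vectors adding up to that of a single
  edge between their other ends. So they may be merged: whichever way the merged edge is oriented,
  the two edges can be oriented to form a path through the common vertex, which
  contributes 0 there. When nothing can be merged any more, all edges are disjoint and every
  orientation is balanced. Merging creates loops and parallel edges, hence the statement about
  arbitrary families of pairs.
\<close>

lemma balanced_signs:
  fixes t h :: "'i \<Rightarrow> 'v"
  assumes "finite I"
  shows "\<exists>s. (\<forall>i. s i = 1 \<or> s i = (-1::int)) \<and>
    (\<forall>v. \<bar>\<Sum>i\<in>I. s i * incidence (t i) (h i) v\<bar> \<le> 1)"
  using assms
proof (induction I arbitrary: t h rule: finite_psubset_induct)
  case (psubset I)
  show ?case
  proof (cases "\<exists>i\<in>I. \<exists>j\<in>I. i \<noteq> j \<and> {t i, h i} \<inter> {t j, h j} \<noteq> {}")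
    case True
    then obtain i j where ij: "i \<in> I" "j \<in> I" "i \<noteq> j" "{t i, h i} \<inter> {t j, h j} \<noteq> {}"
      by blast
    have "\<exists>\<sigma> x y. (\<sigma> = 1 \<or> \<sigma> = (-1::int)) \<and>
      (\<forall>v. incidence x y v = incidence (t i) (h i) v + \<sigma> * incidence (t j) (h j) v)"
    proof -
      consider "h i = t j" | "t i = h j" | "t i = t j" | "h i = h j" using ij(4) by auto
      then show ?thesis
      proof cases
        case 1
        then show ?thesis
          by (intro exI[of _ 1] exI[of _ "t i"] exI[of _ "h j"]) (simp add: incidence_def)
      next
        case 2
        then show ?thesis
          by (intro exI[of _ 1] exI[of _ "t j"] exI[of _ "h i"]) (simp add: incidence_def)
      next
        case 3
        then show ?thesis
          by (intro exI[of _ "-1"] exI[of _ "h j"] exI[of _ "h i"]) (simp add: incidence_def)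
      next
        case 4
        then show ?thesis
          by (intro exI[of _ "-1"] exI[of _ "t i"] exI[of _ "t j"]) (simp add: incidence_def)
      qed
    qed
    then obtain \<sigma> x y where \<sigma>: "\<sigma> = 1 \<or> \<sigma> = (-1::int)"
      and merged: "\<And>v. incidence x y v
        = incidence (t i) (h i) v + \<sigma> * incidence (t j) (h j) v"
      by blast
    have "I - {j} \<subset> I" using ij(2) by blast
    from psubset.IH[OF this, of "t(i := x)" "h(i := y)"] obtain s where
      s: "\<And>k. s k = 1 \<or> s k = (-1::int)" and
      bal: "\<And>v. \<bar>\<Sum>k\<in>I - {j}. s k * incidence ((t(i := x)) k) ((h(i := y)) k) v\<bar> \<le> 1"
      by blast
    define s' where "s' = s(j := \<sigma> * s i)"
    have "s' k = 1 \<or> s' k = -1" for k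
      using s[of k] s[of i] \<sigma> by (auto simp: s'_def)
    moreover have "(\<Sum>k\<in>I. s' k * incidence (t k) (h k) v)
        = (\<Sum>k\<in>I - {j}. s k * incidence ((t(i := x)) k) ((h(i := y)) k) v)" for v
    proof -
      have fin: "finite (I - {j})" "i \<in> I - {j}" using psubset.hyps ij by auto
      have rest: "(\<Sum>k\<in>I - {j} - {i}. s' k * incidence (t k) (h k) v)
          = (\<Sum>k\<in>I - {j} - {i}. s k * incidence ((t(i := x)) k) ((h(i := y)) k) v)"
        by (intro sum.cong) (auto simp: s'_def)
      have "(\<Sum>k\<in>I. s' k * incidence (t k) (h k) v)
          = s' j * incidence (t j) (h j) v + (s' i * incidence (t i) (h i) v
            + (\<Sum>k\<in>I - {j} - {i}. s' k * incidence (t k) (h k) v))"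
        using psubset.hyps ij(2) fin by (simp only: sum.remove)
      also have "\<dots> = s i * incidence x y v
            + (\<Sum>k\<in>I - {j} - {i}. s k * incidence ((t(i := x)) k) ((h(i := y)) k) v)"
        using ij(3) by (simp only: rest merged) (simp add: s'_def algebra_simps)
      also have "\<dots> = (\<Sum>k\<in>I - {j}. s k * incidence ((t(i := x)) k) ((h(i := y)) k) v)"
        using fin by (simp add: sum.remove)
      finally show ?thesis .
    qed
    ultimately show ?thesis using bal by (intro exI[of _ s']) simp
  next
    case False
    have "\<bar>\<Sum>i\<in>I. incidence (t i) (h i) v\<bar> \<le> 1" for v
    proof (cases "\<exists>i\<in>I. v \<in> {t i, h i}")
      case True
      then obtain i where i: "i \<in> I" "v \<in> {t i, h i}" by blast
      have "(\<Sum>k\<in>I - {i}. incidence (t k) (h k) v) = 0"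
        using False i by (intro sum.neutral) (auto simp: incidence_def)
      then show ?thesis
        using psubset.hyps i(1) by (simp add: sum.remove) (simp add: incidence_def)
    next
      case no_end: False
      have "(\<Sum>k\<in>I. incidence (t k) (h k) v) = 0"
        using no_end by (intro sum.neutral) (auto simp: incidence_def)
      then show ?thesis by simp
    qed
    then show ?thesis by (intro exI[of _ "\<lambda>_. 1"]) simp
  qed
qed

lemma balanced_orientation:
  assumes "finite E" "\<And>e. e \<in> E \<Longrightarrow> card e = 2"
  obtains tail head where
    "\<And>e. e \<in> E \<Longrightarrow> e = {tail e, head e} \<and> tail e \<noteq> head e"
    "\<And>v. \<bar>int (card (owned tail E v)) - int (card (owned head E v))\<bar> \<le> 1"
proof -
  have "\<forall>e\<in>E. \<exists>x y. e = {x, y} \<and> x \<noteq> y" using assms(2) by (simp add: card_2_iff)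
  then obtain t h where th: "\<And>e. e \<in> E \<Longrightarrow> e = {t e, h e} \<and> t e \<noteq> h e" by metis
  obtain s where s: "\<And>e. s e = 1 \<or> s e = (-1::int)"
    and bal: "\<And>v. \<bar>\<Sum>e\<in>E. s e * incidence (t e) (h e) v\<bar> \<le> 1"
    using balanced_signs[OF assms(1), of t h] by blast
  define tail where "tail e = (if s e = 1 then t e else h e)" for e
  define head where "head e = (if s e = 1 then h e else t e)" for e
  show thesis
  proof
    show "e = {tail e, head e} \<and> tail e \<noteq> head e" if "e \<in> E" for e
      using th[OF that] by (auto simp: tail_def head_def)
    show "\<bar>int (card (owned tail E v)) - int (card (owned head E v))\<bar> \<le> 1" for v
    proof -
      have count: "int (card (owned f E v)) = (\<Sum>e\<in>E. if v = f e then 1 else 0)" for f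
      proof -
        have "owned f E v = E \<inter> {e. v = f e}" by (auto simp: owned_def)
        then show ?thesis using assms(1) by (simp add: sum.If_cases)
      qed
      have "int (card (owned tail E v)) - int (card (owned head E v))
          = (\<Sum>e\<in>E. incidence (tail e) (head e) v)"
        unfolding count incidence_def by (simp only: sum_subtractf)
      also have "\<dots> = (\<Sum>e\<in>E. s e * incidence (t e) (h e) v)"
      proof (rule sum.cong)
        show "incidence (tail e) (head e) v = s e * incidence (t e) (h e) v" for e
          using s[of e] by (auto simp: tail_def head_def incidence_def)
      qed simp
      finally show ?thesis using bal[of v] by simp
    qed
  qed
qed

text \<open>
  Balance means that the charge is never wasted on one side: one part exceeds 2 only if
  the other is at least 2, and then both charges vanish.
\<close>

lemma charge_balanced_split:
  assumes "\<bar>int a - int b\<bar> \<le> 1"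
  shows "charge a + charge b \<le> 4 - (a + b)"
  using assms by (simp add: charge_def)

theorem untouched_number_le:
  assumes "simple_graph V E"
  shows "4 * untouched_number V E
    \<le> 4 * num_degree V E 0 + 3 * num_degree V E 1 + 2 * num_degree V E 2 + num_degree V E 3"
proof -
  have V: "finite V" and two: "\<And>e. e \<in> E \<Longrightarrow> card e = 2"
    using assms by (auto simp: simple_graph_def)
  have E: "finite E" using assms by (rule simple_graph_finite_edges)
  obtain tail head where
    ends: "\<And>e. e \<in> E \<Longrightarrow> e = {tail e, head e} \<and> tail e \<noteq> head e" and
    bal: "\<And>v. \<bar>int (card (owned tail E v)) - int (card (owned head E v))\<bar> \<le> 1"
    using balanced_orientation[OF E two] by blast
  have deg: "card (owned tail E v) + card (owned head E v) = degree E v" for v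
  proof -
    have mem: "v \<in> e \<longleftrightarrow> tail e = v \<or> head e = v" if "e \<in> E" for e
    proof -
      have "v \<in> e \<longleftrightarrow> v \<in> {tail e, head e}"
        using conjunct1[OF ends[OF that]] by (rule arg_cong)
      then show ?thesis by auto
    qed
    have "{e \<in> E. v \<in> e} = owned tail E v \<union> owned head E v"
      using mem by (auto simp: owned_def)
    moreover have "owned tail E v \<inter> owned head E v = {}"
    proof (rule equals0I)
      fix e assume "e \<in> owned tail E v \<inter> owned head E v"
      then have "e \<in> E" "tail e = head e" by (auto simp: owned_def)
      then show False using ends by blast
    qed
    ultimately show ?thesis using E by (simp add: degree_def owned_def card_Un_disjoint)
  qed
  have U: "untouched V {} = V" by (simp add: untouched_def)
  have num: "num_degree V E i = (\<Sum>v\<in>V. if degree E v = i then 1 else 0)" for i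
    using V by (simp add: num_degree_def sum.If_cases Int_def)
  have "tail e \<in> e" "head e \<in> e" if "e \<in> E" for e
    by (subst (2) conjunct1[OF ends[OF that]], simp)+
  then have "4 * untouched_number V E \<le> potential V tail E {} + potential V head E {}"
    using game_value_le_ownership_potential(1)[OF V E, of tail "{}"]
      game_value_le_ownership_potential(1)[OF V E, of head "{}"]
    unfolding untouched_number_def by fastforce
  also have "\<dots> = (\<Sum>v\<in>V. charge (card (owned tail E v)) + charge (card (owned head E v)))"
    by (simp add: potential_def U sum.distrib)
  also have "\<dots> \<le> (\<Sum>v\<in>V. 4 - degree E v)"
    using charge_balanced_split[OF bal] by (intro sum_mono) (simp add: deg)
  also have "\<dots> = (\<Sum>v\<in>V. 4 * (if degree E v = 0 then 1 else 0)
      + 3 * (if degree E v = 1 then 1 else 0) + 2 * (if degree E v = 2 then 1 else 0)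
      + (if degree E v = 3 then 1 else 0))"
    by (intro sum.cong) auto
  also have "\<dots> = 4 * num_degree V E 0 + 3 * num_degree V E 1 + 2 * num_degree V E 2
      + num_degree V E 3"
    unfolding num by (simp only: sum.distrib sum_distrib_left)
  finally show ?thesis .
qed

section \<open>The bounds\<close>

theorem theorem1p1:
  fixes V :: "'a set" and E :: "'a set set"
  assumes "simple_graph V E"
  shows "real (num_degree V E 0) + 1/2 * real (num_degree V E 1) - 1 \<le> real (untouched_number V E)
    \<and> real (untouched_number V E) \<le> real (num_degree V E 0) + 3/4 * real (num_degree V E 1)
        + 1/2 * real (num_degree V E 2) + 1/4 * real (num_degree V E 3)"
  using untouched_number_ge[OF assms] untouched_number_le[OF assms] by linarith

end
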